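(* Let $G$ be a diamond-free graph. Then $G$ is clique-perfect if and only if $G$ is balanced.
   Context: A graph is diamond-free if it has no induced subgraph isomorphic to $K_4$ minus an edge. A $\{0,1\}$-matrix is balanced if it has no square submatrix of odd order with exactly two 1's in every row and every column; a graph is balanced if its clique-matrix (rows = incidence vectors of maximal cliques, columns = vertices) is balanced. A clique-transversal of $G$ is a set of vertices meeting every maximal clique; $\tau_c(G)$ is the minimum size of a clique-transversal. A clique-independent set is a collection of pairwise vertex-disjoint maximal cliques; $\alpha_c(G)$ is the maximum size of one. $G$ is clique-perfect if $\tau_c(G')=\alpha_c(G')$ for every induced subgraph $G'$ of $G$. *)

theory Defs
  imports Main
begin

text \<open>A finite simple graph is given by a finite vertex set V and a symmetric,
irreflexive edge relation E on V. The induced subgraph on V' \<subseteq> V is (V', E)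
(the edge relation is only ever consulted between vertices of V').\<close>

definition simple_graph :: "'a set \<Rightarrow> ('a \<Rightarrow> 'a \<Rightarrow> bool) \<Rightarrow> bool" where
  "simple_graph V E \<longleftrightarrow> finite V \<and> (\<forall>x y. E x y \<longrightarrow> x \<in> V \<and> y \<in> V)
     \<and> (\<forall>x y. E x y \<longrightarrow> E y x) \<and> (\<forall>x. \<not> E x x)"

definition is_clique :: "'a set \<Rightarrow> ('a \<Rightarrow> 'a \<Rightarrow> bool) \<Rightarrow> 'a set \<Rightarrow> bool" where
  "is_clique V E K \<longleftrightarrow> K \<subseteq> V \<and> K \<noteq> {} \<and> (\<forall>x\<in>K. \<forall>y\<in>K. x \<noteq> y \<longrightarrow> E x y)"

definition max_clique :: "'a set \<Rightarrow> ('a \<Rightarrow> 'a \<Rightarrow> bool) \<Rightarrow> 'a set \<Rightarrow> bool" where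
  "max_clique V E K \<longleftrightarrow> is_clique V E K \<and> (\<forall>K'. is_clique V E K' \<and> K \<subseteq> K' \<longrightarrow> K' = K)"

definition max_cliques :: "'a set \<Rightarrow> ('a \<Rightarrow> 'a \<Rightarrow> bool) \<Rightarrow> 'a set set" where
  "max_cliques V E = {K. max_clique V E K}"

definition diamond_free :: "'a set \<Rightarrow> ('a \<Rightarrow> 'a \<Rightarrow> bool) \<Rightarrow> bool" where
  "diamond_free V E \<longleftrightarrow> \<not> (\<exists>a\<in>V. \<exists>b\<in>V. \<exists>c\<in>V. \<exists>d\<in>V.
      distinct [a, b, c, d] \<and> E a b \<and> E a c \<and> E a d \<and> E b c \<and> E b d \<and> \<not> E c d)"

definition balanced_matrix :: "'r set \<Rightarrow> 'c set \<Rightarrow> ('r \<Rightarrow> 'c \<Rightarrow> bool) \<Rightarrow> bool" where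
  "balanced_matrix R C M \<longleftrightarrow> \<not> (\<exists>Rs Cs. Rs \<subseteq> R \<and> Cs \<subseteq> C \<and> finite Rs \<and> finite Cs \<and>
      card Rs = card Cs \<and> odd (card Rs) \<and>
      (\<forall>r\<in>Rs. card {c\<in>Cs. M r c} = 2) \<and> (\<forall>c\<in>Cs. card {r\<in>Rs. M r c} = 2))"

definition balanced_graph :: "'a set \<Rightarrow> ('a \<Rightarrow> 'a \<Rightarrow> bool) \<Rightarrow> bool" where
  "balanced_graph V E \<longleftrightarrow> balanced_matrix (max_cliques V E) V (\<lambda>K v. v \<in> K)"

definition clique_transversal :: "'a set \<Rightarrow> ('a \<Rightarrow> 'a \<Rightarrow> bool) \<Rightarrow> 'a set \<Rightarrow> bool" where
  "clique_transversal V E T \<longleftrightarrow> T \<subseteq> V \<and> (\<forall>K\<in>max_cliques V E. T \<inter> K \<noteq> {})"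

definition tau_c :: "'a set \<Rightarrow> ('a \<Rightarrow> 'a \<Rightarrow> bool) \<Rightarrow> nat" where
  "tau_c V E = Min {card T | T. clique_transversal V E T}"

definition clique_independent :: "'a set \<Rightarrow> ('a \<Rightarrow> 'a \<Rightarrow> bool) \<Rightarrow> 'a set set \<Rightarrow> bool" where
  "clique_independent V E F \<longleftrightarrow> F \<subseteq> max_cliques V E \<and>
      (\<forall>K1\<in>F. \<forall>K2\<in>F. K1 \<noteq> K2 \<longrightarrow> K1 \<inter> K2 = {})"

definition alpha_c :: "'a set \<Rightarrow> ('a \<Rightarrow> 'a \<Rightarrow> bool) \<Rightarrow> nat" where
  "alpha_c V E = Max {card F | F. clique_independent V E F}"

definition clique_perfect :: "'a set \<Rightarrow> ('a \<Rightarrow> 'a \<Rightarrow> bool) \<Rightarrow> bool" where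
  "clique_perfect V E \<longleftrightarrow> (\<forall>V'. V' \<subseteq> V \<longrightarrow> tau_c V' E = alpha_c V' E)"

end

theory Submission
  imports Defs "HOL-Library.FuncSet"
begin

text \<open>If G is not balanced, let W be the columns of a forbidden odd submatrix of order k. By
diamond-freeness the k cliques of the submatrix meet W in pairs that are maximal cliques of G[W].
A vertex of W lies in two of them, so a clique-transversal of G[W] has at least k/2 elements; every
maximal clique of G[W] has at least two vertices, so a clique-independent set has at most k/2
elements. As k is odd, the two numbers differ.

Conversely, balanced graphs satisfy the Berge--Las Vergnas min-max theorem even without
diamond-freeness. A balanced matrix can be bicoloured; recolouring two colour classes at a time
gives an edge colouring with as many colours as the maximum degree. If every one of the n vertices
v were missed by some maximum matching F(v), the union of the F(v), with multiplicities, would have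
maximum degree at most n - 1, so one of its n - 1 colour classes would be a matching larger than
F(v). Hence some vertex meets all maximum matchings; delete the edges through it and induct.\<close>

section \<open>Balanced matrices: transposes and pullbacks\<close>

lemma balanced_matrixD:
  assumes "balanced_matrix R C M" "Rs \<subseteq> R" "Cs \<subseteq> C" "finite Rs" "finite Cs"
    "card Rs = card Cs" "odd (card Rs)"
    "\<And>r. r \<in> Rs \<Longrightarrow> card {c\<in>Cs. M r c} = 2" "\<And>c. c \<in> Cs \<Longrightarrow> card {r\<in>Rs. M r c} = 2"
  shows False
  using assms unfolding balanced_matrix_def by blast

lemma balanced_matrix_transpose:
  assumes "balanced_matrix R C M"
  shows "balanced_matrix C R (\<lambda>c r. M r c)"
  unfolding balanced_matrix_def[of C]
proof (intro notI, elim exE conjE)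
  fix Cs Rs
  assume "Cs \<subseteq> C" "Rs \<subseteq> R" "finite Cs" "finite Rs" "card Cs = card Rs" "odd (card Cs)"
    "\<forall>c\<in>Cs. card {r\<in>Rs. M r c} = 2" "\<forall>r\<in>Rs. card {c\<in>Cs. M r c} = 2"
  then show False by (intro balanced_matrixD[OF assms, of Rs Cs]) simp_all
qed

text \<open>The map g need not be injective: two equal rows of a forbidden submatrix share both of their
columns, and removing these two rows and columns leaves a smaller forbidden submatrix.\<close>

lemma balanced_matrix_pullback:
  assumes bal: "balanced_matrix R C M" and g: "\<And>r. r \<in> R' \<Longrightarrow> g r \<in> R" and "C' \<subseteq> C"
    and M': "\<And>r c. r \<in> R' \<Longrightarrow> c \<in> C' \<Longrightarrow> M' r c \<longleftrightarrow> M (g r) c"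
  shows "balanced_matrix R' C' M'"
proof -
  have "\<not> (\<forall>c\<in>Cs. card {r\<in>Rs. M' r c} = 2)"
    if "Rs \<subseteq> R'" "Cs \<subseteq> C'" "finite Rs" "finite Cs" "card Rs = card Cs" "odd (card Rs)"
      "\<forall>r\<in>Rs. card {c\<in>Cs. M' r c} = 2" for Rs Cs
    using that
  proof (induction "card Rs" arbitrary: Rs Cs rule: less_induct)
    case less
    have Mg: "M' r c \<longleftrightarrow> M (g r) c" if "r \<in> Rs" "c \<in> Cs" for r c
      by (rule M') (use that less.prems(1,2) in blast)+
    show ?case
    proof
      assume cols: "\<forall>c\<in>Cs. card {r\<in>Rs. M' r c} = 2"
      show False
      proof (cases "inj_on g Rs")
        case True
        have 1: "card {c\<in>Cs. M (g r) c} = 2" if "r \<in> Rs" for r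
        proof -
          have "{c\<in>Cs. M (g r) c} = {c\<in>Cs. M' r c}"
            using that by (auto simp: Mg)
          then show ?thesis using that less.prems(7) by simp
        qed
        have 2: "card {r\<in>g ` Rs. M r c} = 2" if "c \<in> Cs" for c
        proof -
          have "{r\<in>g ` Rs. M r c} = g ` {r\<in>Rs. M' r c}"
            using that by (auto simp: Mg)
          moreover have "inj_on g {r\<in>Rs. M' r c}"
            using True by (rule inj_on_subset) auto
          ultimately show ?thesis using that cols by (simp add: card_image)
        qed
        have "g ` Rs \<subseteq> R" "Cs \<subseteq> C" "card (g ` Rs) = card Rs"
          using less.prems g \<open>C' \<subseteq> C\<close> card_image[OF True] by auto
        then show False
          using 1 2 less.prems(3-6) by (intro balanced_matrixD[OF bal, of "g ` Rs" Cs]) auto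
      next
        case False
        then obtain r1 r2 where r: "r1 \<in> Rs" "r2 \<in> Rs" "r1 \<noteq> r2" "g r1 = g r2"
          unfolding inj_on_def by blast
        define D where "D = {c\<in>Cs. M' r1 c}"
        have D: "D \<subseteq> Cs" "card D = 2" using r less.prems(7) unfolding D_def by auto
        have D2: "D = {c\<in>Cs. M' r2 c}"
          using r(4) Mg[OF r(1)] Mg[OF r(2)] unfolding D_def by auto
        \<comment> \<open>Both ones of a column in \<open>D\<close> lie in \<open>r1\<close> and
          \<open>r2\<close>, so removing \<open>D\<close> takes no entry from any other row.\<close>
        have rows_D: "{r\<in>Rs. M' r c} = {r1, r2}" if "c \<in> D" for c
        proof -
          have "{r1, r2} \<subseteq> {r\<in>Rs. M' r c}" using that r D2 unfolding D_def by auto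
          moreover have "card {r\<in>Rs. M' r c} = card {r1, r2}"
            using cols that D(1) r(3) by auto
          ultimately show ?thesis
            using card_subset_eq[of "{r\<in>Rs. M' r c}" "{r1, r2}"] less.prems(3) by simp
        qed
        let ?Rs = "Rs - {r1, r2}" and ?Cs = "Cs - D"
        have fD: "finite D" using D(1) less.prems(4) finite_subset by blast
        have cR: "card ?Rs = card Rs - 2" using r less.prems(3) by (simp add: card_Diff_subset)
        have cC: "card ?Cs = card Cs - 2" using D fD by (simp add: card_Diff_subset)
        \<comment> \<open>Truncated subtraction of 2 preserves parity only above this bound.\<close>
        have ge: "card Rs \<ge> 2" using D less.prems(4,5) card_mono by metis
        have "\<forall>r\<in>?Rs. card {c\<in>?Cs. M' r c} = 2"
        proof
          fix r assume rr: "r \<in> ?Rs"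
          then have "{c\<in>?Cs. M' r c} = {c\<in>Cs. M' r c}" using rows_D by blast
          then show "card {c\<in>?Cs. M' r c} = 2" using rr less.prems(7) by auto
        qed
        moreover have "\<forall>c\<in>?Cs. card {r\<in>?Rs. M' r c} = 2"
        proof
          fix c assume cc: "c \<in> ?Cs"
          then have "{r\<in>?Rs. M' r c} = {r\<in>Rs. M' r c}" using D2 unfolding D_def by blast
          then show "card {r\<in>?Rs. M' r c} = 2" using cc cols by auto
        qed
        moreover have "card ?Rs < card Rs" "odd (card ?Rs)" "card ?Rs = card ?Cs"
          using cR cC ge less.prems(5,6) by auto
        ultimately show False using less.hyps[of ?Rs ?Cs] less.prems by blast
      qed
    qed
  qed
  then show ?thesis unfolding balanced_matrix_def by blast
qed

section \<open>Odd cycles and bicolourings\<close>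

text \<open>A shortest odd closed walk is simple: a repeated vertex would split it into two shorter
  closed walks, and one of them would have odd length.\<close>

lemma odd_simple_cycle:
  assumes "odd n" "(x, x) \<in> G ^^ n"
  obtains f m where "odd m" "f m = f 0" "\<And>i. i < m \<Longrightarrow> (f i, f (Suc i)) \<in> G"
    "inj_on f {..<m}"
proof -
  define P where "P m \<longleftrightarrow> odd m \<and> (\<exists>x. (x, x) \<in> G ^^ m)" for m
  have "P n" using assms P_def by blast
  then have Pm: "P (Least P)" and least: "\<And>k. P k \<Longrightarrow> Least P \<le> k"
    by (auto intro: LeastI Least_le)
  define m where "m = Least P"
  obtain y where "odd m" "(y, y) \<in> G ^^ m" using Pm unfolding P_def m_def by blast
  then obtain f where f: "f 0 = y" "f m = y" "\<And>i. i < m \<Longrightarrow> (f i, f (Suc i)) \<in> G"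
    unfolding relpow_fun_conv by blast
  have walk: "(f i, f (i + k)) \<in> G ^^ k" if "i + k \<le> m" for i k
    unfolding relpow_fun_conv using that f(3) by (intro exI[of _ "\<lambda>t. f (i + t)"]) auto
  have "f i \<noteq> f j" if ij: "i < j" "j < m" for i j
  proof
    assume eq: "f i = f j"
    have "(f i, f i) \<in> G ^^ (j - i)" using walk[of i "j - i"] ij eq by simp
    moreover have "(f 0, f 0) \<in> G ^^ (i + (m - j))"
      unfolding relpow_add using walk[of 0 i] walk[of j "m - j"] ij eq f(1,2)
      by (intro relcompI[of _ "f j"]) auto
    moreover have "odd (j - i) \<or> odd (i + (m - j))" using \<open>odd m\<close> ij by presburger
    ultimately have "P (j - i) \<or> P (i + (m - j))" unfolding P_def by blast
    then have "m \<le> j - i \<or> m \<le> i + (m - j)" using least unfolding m_def by blast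
    then show False using ij by linarith
  qed
  then have "inj_on f {..<m}" by (intro linorder_inj_onI) auto
  then show thesis using that[of m f] f \<open>odd m\<close> by auto
qed

text \<open>\<open>G\<close> joins the two columns of each row with exactly two ones. The vertices
  of a simple odd cycle in \<open>G\<close>, with the rows that yield its edges, form a forbidden
  submatrix.\<close>

lemma balanced_no_odd_cycle:
  assumes bal: "balanced_matrix R C M"
    and G: "G = {(x, y). x \<noteq> y \<and> (\<exists>r\<in>R. {c\<in>C. M r c} = {x, y})}"
    and "odd n"
  shows "(x, x) \<notin> G ^^ n"
proof
  assume "(x, x) \<in> G ^^ n"
  with \<open>odd n\<close> obtain f m where f: "odd m" "f m = f 0" "\<And>i. i < m \<Longrightarrow> (f i, f (Suc i)) \<in> G"
    and inj: "inj_on f {..<m}" by (rule odd_simple_cycle) blast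
  \<comment> \<open>\<open>G\<close> has no loops, which excludes length 1.\<close>
  have "m \<noteq> 1" using f(2) f(3)[of 0] G by auto
  then have m3: "m \<ge> 3" using \<open>odd m\<close> by presburger
  \<comment> \<open>\<open>s\<close> is the cyclic successor on the indices below \<open>m\<close>,
    the range where \<open>f\<close> is injective.\<close>
  define s where "s i = (if Suc i = m then 0 else Suc i)" for i
  have s: "s i < m" "f (Suc i) = f (s i)" if "i < m" for i
    using that f(2) by (auto simp: s_def)
  obtain r where r: "\<And>i. i < m \<Longrightarrow> r i \<in> R \<and> {c\<in>C. M (r i) c} = {f i, f (s i)}"
  proof -
    have "\<forall>i. \<exists>r. i < m \<longrightarrow> r \<in> R \<and> {c\<in>C. M r c} = {f i, f (s i)}"
      using f(3) s(2) unfolding G by fastforce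
    then show thesis using that by metis
  qed
  have fC: "f i \<in> C" if "i < m" for i using r[OF that] by blast
  have M_iff: "M (r j) (f i) \<longleftrightarrow> i = j \<or> i = s j" if "i < m" "j < m" for i j
  proof -
    have "M (r j) (f i) \<longleftrightarrow> f i \<in> {f j, f (s j)}" using r[OF that(2)] fC[OF that(1)] by blast
    then show ?thesis using inj that s(1)[OF that(2)] by (auto simp: inj_on_def)
  qed
  have inj_r: "inj_on r {..<m}"
  proof (rule inj_onI)
    fix i j assume ij: "i \<in> {..<m}" "j \<in> {..<m}" "r i = r j"
    \<comment> \<open>Equal rows with distinct indices would make \<open>i\<close> and
      \<open>j\<close> successors of each other, which a cycle of length at least 3 does not
      allow.\<close>
    then have "i = j \<or> i = s j" "j = i \<or> j = s i"
      using M_iff[of i j] M_iff[of j i] M_iff[of i i] M_iff[of j j] by auto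
    then show "i = j" using ij m3 by (auto simp: s_def split: if_splits)
  qed
  let ?Rs = "r ` {..<m}" and ?Cs = "f ` {..<m}"
  have "card {c\<in>?Cs. M x c} = 2" if x: "x \<in> ?Rs" for x
  proof -
    obtain j where j: "j < m" "x = r j" using x by blast
    have "{c\<in>?Cs. M x c} = f ` {j, s j}" using j M_iff s(1) by auto
    moreover have "inj_on f {j, s j}" using inj j s(1) by (auto simp: inj_on_def)
    moreover have "j \<noteq> s j" using m3 by (auto simp: s_def)
    ultimately show ?thesis by (simp add: card_image)
  qed
  moreover have "card {x\<in>?Rs. M x c} = 2" if c: "c \<in> ?Cs" for c
  proof -
    obtain i where i: "i < m" "c = f i" using c by blast
    \<comment> \<open>\<open>p\<close> is the cyclic predecessor of \<open>i\<close>, so column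
      \<open>f i\<close> has its ones in rows \<open>r i\<close> and \<open>r p\<close>.\<close>
    define p where "p = (if i = 0 then m - 1 else i - 1)"
    have p: "p < m" "p \<noteq> i" using i m3 by (auto simp: p_def)
    have "i = s j \<longleftrightarrow> j = p" if "j < m" for j using that i m3 by (auto simp: p_def s_def)
    then have "{x\<in>?Rs. M x c} = r ` {i, p}" using i M_iff p by auto
    moreover have "inj_on r {i, p}" using inj_r i p by (auto simp: inj_on_def)
    ultimately show ?thesis using p(2) by (simp add: card_image)
  qed
  moreover have "?Rs \<subseteq> R" "?Cs \<subseteq> C" using r fC by auto
  moreover have "card ?Rs = m" "card ?Cs = m" using inj inj_r by (simp_all add: card_image)
  ultimately show False
    using \<open>odd m\<close> by (intro balanced_matrixD[OF bal, of ?Rs ?Cs]) auto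
qed

text \<open>A vertex z at maximum distance from a root: deleting it does not disconnect its neighbours,
which all lie at the same distance, so any 2-colouring h of the rest gives them the same colour.\<close>

lemma odd_walk_free_vertex:
  fixes G :: "('a \<times> 'a) set"
  assumes "finite C" "C \<noteq> {}" "G \<subseteq> C \<times> C" and sym: "sym G"
    and no_odd: "\<And>x n. odd n \<Longrightarrow> (x, x) \<notin> G ^^ n"
  obtains z where "z \<in> C"
    "\<And>h. (\<And>x y. (x, y) \<in> G \<Longrightarrow> x \<noteq> z \<Longrightarrow> y \<noteq> z \<Longrightarrow> h x \<noteq> h y) \<Longrightarrow>
       \<exists>b::bool. \<forall>a. (a, z) \<in> G \<longrightarrow> h a = b"
proof -
  obtain r where "r \<in> C" using assms(2) by blast
  \<comment> \<open>The distance from \<open>r\<close>, meaningful only on the component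
    \<open>?Y\<close> of \<open>r\<close>.\<close>
  define d where "d y = (LEAST n. (r, y) \<in> G ^^ n)" for y
  let ?Y = "{y\<in>C. \<exists>n. (r, y) \<in> G ^^ n}"
  have rY: "r \<in> ?Y" using \<open>r \<in> C\<close> by (auto intro: exI[of _ 0])
  have dw: "(r, y) \<in> G ^^ d y" if "(r, y) \<in> G ^^ n" for y n
    unfolding d_def using that by (rule LeastI)
  have dle: "d y \<le> n" if "(r, y) \<in> G ^^ n" for y n
    unfolding d_def using that by (rule Least_le)
  have fin: "finite (d ` ?Y)" "d ` ?Y \<noteq> {}" using assms(1) rY by auto
  obtain z where zY: "z \<in> ?Y" and dz: "d z = Max (d ` ?Y)" using Max_in[OF fin] by force
  have zmax: "d y \<le> d z" if "y \<in> ?Y" for y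
    unfolding dz by (rule Max_ge[OF fin(1)]) (rule imageI[OF that])
  have nbY: "y \<in> ?Y" if "(x, y) \<in> G" "x \<in> ?Y" for x y
    using that assms(3) by (blast intro: relpow_Suc_I)
  have sym': "(y, x) \<in> G" if "(x, y) \<in> G" for x y using sym that by (rule symD)
  have symG: "(x, y) \<in> G ^^ n \<Longrightarrow> (y, x) \<in> G ^^ n" for x y n
  proof (induction n arbitrary: x)
    case (Suc n)
    then obtain w where "(x, w) \<in> G" "(w, y) \<in> G ^^ n" by (blast elim: relpow_Suc_E2)
    then show ?case using Suc.IH[of w] sym'[of x w] by (blast intro: relpow_Suc_I)
  qed simp
  show thesis
  proof (rule that[of z])
    show "z \<in> C" using zY by blast
    fix h :: "'a \<Rightarrow> bool"
    assume h: "\<And>x y. (x, y) \<in> G \<Longrightarrow> x \<noteq> z \<Longrightarrow> y \<noteq> z \<Longrightarrow> h x \<noteq> h y"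
    \<comment> \<open>A shortest walk from \<open>r\<close> to a vertex closer than \<open>z\<close>
      avoids \<open>z\<close>, so \<open>h\<close> alternates along it.\<close>
    have col: "h y = (h r = even (d y))" if "(r, y) \<in> G ^^ n" "d y < d z" for y n
      using that
    proof (induction "d y" arbitrary: y n rule: less_induct)
      case less
      show ?case
      proof (cases "d y")
        case 0
        then show ?thesis using dw[OF less.prems(1)] by simp
      next
        case (Suc k)
        then obtain w where w: "(r, w) \<in> G ^^ k" "(w, y) \<in> G"
          using dw[OF less.prems(1)] by auto
        have "d w \<le> k" using dle w(1) by blast
        moreover have "d y \<le> Suc (d w)" using dle[OF relpow_Suc_I[OF dw[OF w(1)] w(2)]] .
        ultimately have dk: "d w = k" using Suc by simp
        then have "h w = (h r = even (d w))" using less.hyps[of w] w(1) less.prems(2) Suc by auto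
        moreover have "w \<noteq> z" "y \<noteq> z" using dk Suc less.prems(2) by auto
        ultimately show ?thesis using h[OF w(2)] dk Suc by auto
      qed
    qed
    \<comment> \<open>The distances of \<open>a\<close> and \<open>z\<close> differ by at most one;
      if they were equal, the edge between them would close an odd walk through
      \<open>r\<close>.\<close>
    have "d a = d z - 1 \<and> h a = (h r = even (d z - 1))" if a: "(a, z) \<in> G" for a
    proof -
      have "(z, a) \<in> G" using a by (rule sym')
      then have aY: "a \<in> ?Y" using nbY zY by blast
      then obtain n where n: "(r, a) \<in> G ^^ n" by blast
      have le: "d a \<le> d z" using zmax aY by blast
      have ge: "d z \<le> Suc (d a)" using dle[OF relpow_Suc_I[OF dw[OF n] a]] .
      have "(r, z) \<in> G ^^ d z" using zY dw by blast
      then have "(z, r) \<in> G ^^ d z" by (rule symG)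
      moreover have "(r, z) \<in> G ^^ Suc (d a)" using dw[OF n] a by (rule relpow_Suc_I)
      ultimately have "(r, r) \<in> G ^^ (Suc (d a) + d z)" by (simp only: relpow_add) (rule relcompI)
      then have "even (Suc (d a) + d z)" using no_odd by blast
      then have "d a \<noteq> d z" by auto
      then have "d a = d z - 1" "d a < d z" using le ge by auto
      then show ?thesis using col[OF n] by simp
    qed
    then show "\<exists>b. \<forall>a. (a, z) \<in> G \<longrightarrow> h a = b" by blast
  qed
qed

text \<open>Induction on the columns: delete a vertex \<open>z\<close> whose neighbours in the graph
  of two-entry rows are forced to share a colour, bicolour the rest, and give \<open>z\<close> the
  opposite colour.\<close>

lemma balanced_bicolouring:
  assumes "finite C" "balanced_matrix R C M"
  obtains h :: "'c \<Rightarrow> bool" where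
    "\<And>r. r \<in> R \<Longrightarrow> card {c\<in>C. M r c} \<ge> 2 \<Longrightarrow> h ` {c\<in>C. M r c} = UNIV"
proof -
  have "\<exists>h :: 'c \<Rightarrow> bool. \<forall>r\<in>R. card {c\<in>C. M r c} \<ge> 2 \<longrightarrow> h ` {c\<in>C. M r c} = UNIV"
    using assms
  proof (induction C rule: finite_psubset_induct)
    case (psubset C)
    show ?case
    proof (cases "C = {}")
      case True
      then show ?thesis by simp
    next
      case False
      \<comment> \<open>Only rows with exactly two entries can become monochromatic when z is put back.\<close>
      define G where "G = {(x, y). x \<noteq> y \<and> (\<exists>r\<in>R. {c\<in>C. M r c} = {x, y})}"
      have sub: "G \<subseteq> C \<times> C" unfolding G_def by blast
      have sym: "sym G" unfolding G_def sym_def by (auto simp: insert_commute)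
      obtain z where z: "z \<in> C"
        "\<And>h. (\<And>x y. (x, y) \<in> G \<Longrightarrow> x \<noteq> z \<Longrightarrow> y \<noteq> z \<Longrightarrow> h x \<noteq> h y) \<Longrightarrow>
          \<exists>b::bool. \<forall>a. (a, z) \<in> G \<longrightarrow> h a = b"
        using odd_walk_free_vertex[OF psubset.hyps False sub sym
            balanced_no_odd_cycle[OF psubset.prems G_def]] by blast
      have "balanced_matrix R (C - {z}) M"
        by (rule balanced_matrix_pullback[OF psubset.prems, of _ id]) auto
      moreover have "C - {z} \<subset> C" using z(1) by blast
      ultimately have "\<exists>h :: 'c \<Rightarrow> bool. \<forall>r\<in>R. card {c\<in>C-{z}. M r c} \<ge> 2 \<longrightarrow>
          h ` {c\<in>C-{z}. M r c} = UNIV"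
        by (rule psubset.IH[rotated])
      then obtain h :: "'c \<Rightarrow> bool" where
        h: "\<And>r. r \<in> R \<Longrightarrow> card {c\<in>C-{z}. M r c} \<ge> 2 \<Longrightarrow> h ` {c\<in>C-{z}. M r c} = UNIV"
        by blast
      \<comment> \<open>An edge of \<open>G\<close> avoiding \<open>z\<close> comes from a row that
        keeps both entries when \<open>z\<close> is deleted, so \<open>h\<close> already splits
        it.\<close>
      have "h x \<noteq> h y" if xy: "(x, y) \<in> G" "x \<noteq> z" "y \<noteq> z" for x y
      proof -
        obtain r where r: "r \<in> R" "{c\<in>C. M r c} = {x, y}" "x \<noteq> y" using xy(1) G_def by auto
        then have "{c\<in>C. M r c} - {z} = {x, y}" using xy(2,3) by simp
        moreover have "{c\<in>C-{z}. M r c} = {c\<in>C. M r c} - {z}" by blast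
        ultimately have "{c\<in>C-{z}. M r c} = {x, y}" by simp
        then have "h ` {x, y} = UNIV" using h[OF r(1)] r(3) by simp
        then show ?thesis by (auto simp: UNIV_bool doubleton_eq_iff)
      qed
      then have "\<exists>b. \<forall>a. (a, z) \<in> G \<longrightarrow> h a = b" by (rule z(2))
      then obtain b where b: "\<And>a. (a, z) \<in> G \<Longrightarrow> h a = b" by blast
      define h' where "h' = h(z := \<not> b)"
      have "h' ` {c\<in>C. M r c} = UNIV" if r: "r \<in> R" "card {c\<in>C. M r c} \<ge> 2" for r
      proof (cases "card {c\<in>C-{z}. M r c} \<ge> 2")
        case True
        have "h' ` {c\<in>C-{z}. M r c} = h ` {c\<in>C-{z}. M r c}"
          unfolding h'_def by (intro image_cong) auto
        then have "h' ` {c\<in>C-{z}. M r c} = UNIV" using h[OF r(1) True] by simp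
        then show ?thesis by blast
      next
        case False
        \<comment> \<open>In this case the row is \<open>{a, z}\<close> with \<open>a\<close>
          adjacent to \<open>z\<close> in \<open>G\<close>; so \<open>h a = b\<close>, and
          \<open>z\<close> has received the other colour.\<close>
        have eq: "{c\<in>C-{z}. M r c} = {c\<in>C. M r c} - {z}" by blast
        have zr: "z \<in> {c\<in>C. M r c}" using False r(2) eq by (cases "z \<in> {c\<in>C. M r c}") simp_all
        then have "card ({c\<in>C. M r c} - {z}) = 1" using False r(2) card_Diff_singleton[OF zr]
          unfolding eq by linarith
        then obtain a where a: "{c\<in>C. M r c} - {z} = {a}" by (auto simp: card_1_singleton_iff)
        then have "a \<noteq> z" "{c\<in>C. M r c} = {a, z}" using insert_Diff[OF zr] by auto
        then have "h a = b" using b r(1) unfolding G_def by blast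
        then have "h' ` {a, z} = {b, \<not> b}" unfolding h'_def using \<open>a \<noteq> z\<close> by auto
        also have "\<dots> = UNIV" by auto
        finally show ?thesis using \<open>{c\<in>C. M r c} = {a, z}\<close> by simp
      qed
      then show ?thesis by blast
    qed
  qed
  then show thesis using that by blast
qed

section \<open>Edge colourings of balanced hypergraphs\<close>

text \<open>Edges are indexed by \<open>J\<close> so that a vertex set may occur several times. If a
  colour repeats at \<open>u\<close>, another is missing there; bicolouring the edges of these two
  colours shows one more colour at \<open>u\<close> and no fewer anywhere else.\<close>

lemma balanced_edge_colouring:
  fixes S :: "'j \<Rightarrow> 'v set"
  assumes "finite J" "finite V" and bal: "balanced_matrix J V (\<lambda>j v. v \<in> S j)"
    and deg: "\<And>v. v \<in> V \<Longrightarrow> card {j\<in>J. v \<in> S j} \<le> d" and "d > 0"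
  obtains f :: "'j \<Rightarrow> nat" where "f \<in> J \<rightarrow> {..<d}"
    "\<And>v. v \<in> V \<Longrightarrow> inj_on f {j\<in>J. v \<in> S j}"
proof -
  let ?D = "\<lambda>v. {j\<in>J. v \<in> S j}"
  have finD: "finite (?D v)" for v using assms(1) by simp
  define w where "w f = (\<Sum>v\<in>V. card (f ` ?D v))" for f :: "'j \<Rightarrow> nat"
  have "w f < Suc (\<Sum>v\<in>V. card (?D v))" for f
    unfolding w_def less_Suc_eq_le by (intro sum_mono card_image_le finD)
  moreover have "(\<lambda>_. 0) \<in> J \<rightarrow> {..<d}" using \<open>d > 0\<close> by simp
  \<comment> \<open>f maximises the total number of colours seen by the vertices.\<close>
  ultimately obtain f where f: "f \<in> J \<rightarrow> {..<d}" and fmax: "\<And>g. g \<in> J \<rightarrow> {..<d} \<Longrightarrow> w g \<le> w f"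
    using ex_has_greatest_nat[of "\<lambda>f. f \<in> J \<rightarrow> {..<d}" "\<lambda>_. 0" w] by blast
  have "inj_on f (?D u)" if u: "u \<in> V" for u
  proof (rule ccontr)
    assume ninj: "\<not> inj_on f (?D u)"
    then obtain j1 j2 where j: "j1 \<in> ?D u" "j2 \<in> ?D u" "j1 \<noteq> j2" "f j1 = f j2"
      unfolding inj_on_def by blast
    \<comment> \<open>With degree at most \<open>d\<close> and a repeated colour, \<open>u\<close>
      sees fewer than \<open>d\<close> colours; \<open>q\<close> is one it misses.\<close>
    have "card (f ` ?D u) < d"
      using ninj deg[OF u] card_image_le[OF finD, of f u] eq_card_imp_inj_on[OF finD, of f u] by linarith
    then have "\<not> {..<d} \<subseteq> f ` ?D u" using card_mono[OF finite_imageI[OF finD], of "{..<d}" f u] by auto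
    then obtain q where q: "q < d" "q \<notin> f ` ?D u" by auto
    define p where "p = f j1"
    define J' where "J' = {j\<in>J. f j = p \<or> f j = q}"
    have pd: "p < d" using f j(1) unfolding p_def by auto
    have pq: "p \<noteq> q" using q(2) j(1) unfolding p_def by blast
    have J': "J' \<subseteq> J" "finite J'" using assms(1) unfolding J'_def by auto
    have balJ': "balanced_matrix J' V (\<lambda>j v. v \<in> S j)"
      by (rule balanced_matrix_pullback[OF bal, of _ id]) (use J'(1) in auto)
    \<comment> \<open>The matrix is transposed because edges, not vertices, are to be
      bicoloured.\<close>
    obtain h :: "'j \<Rightarrow> bool" where
      h: "\<And>v. v \<in> V \<Longrightarrow> card {j\<in>J'. v \<in> S j} \<ge> 2 \<Longrightarrow> h ` {j\<in>J'. v \<in> S j} = UNIV"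
      by (rule balanced_bicolouring[OF J'(2) balanced_matrix_transpose[OF balJ']]) (rule that, simp)
    define g where "g j = (if j \<in> J' then if h j then p else q else f j)" for j
    have gd: "g \<in> J \<rightarrow> {..<d}" using f pd q(1) unfolding g_def by auto
    \<comment> \<open>Stated for a general \<open>k\<close> to serve both \<open>f\<close> and
      \<open>g\<close>: the colours used on \<open>J'\<close> are disjoint from those used
      elsewhere.\<close>
    have split: "card (k ` ?D v) = card (k ` (?D v - J')) + card (k ` {j\<in>J'. v \<in> S j})"
      if "\<And>j. j \<in> J' \<Longrightarrow> k j \<in> {p, q}" "\<And>j. j \<in> J - J' \<Longrightarrow> k j \<notin> {p, q}" for k v
    proof -
      have "k ` ?D v = k ` (?D v - J') \<union> k ` {j\<in>J'. v \<in> S j}" using J'(1) by blast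
      moreover have "k ` (?D v - J') \<inter> k ` {j\<in>J'. v \<in> S j} = {}" using that by fastforce
      ultimately show ?thesis using finD J'(2) by (simp add: card_Un_disjoint)
    qed
    have splitf: "card (f ` ?D v) = card (f ` (?D v - J')) + card (f ` {j\<in>J'. v \<in> S j})" for v
      by (rule split) (auto simp: J'_def)
    have splitg: "card (g ` ?D v) = card (f ` (?D v - J')) + card (g ` {j\<in>J'. v \<in> S j})" for v
    proof -
      have "card (g ` ?D v) = card (g ` (?D v - J')) + card (g ` {j\<in>J'. v \<in> S j})"
        by (rule split) (auto simp: J'_def g_def)
      moreover have "g ` (?D v - J') = f ` (?D v - J')"
        by (intro image_cong) (auto simp: g_def)
      ultimately show ?thesis by simp
    qed
    have g2: "card (g ` {j\<in>J'. v \<in> S j}) = 2" if "v \<in> V" "card {j\<in>J'. v \<in> S j} \<ge> 2" for v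
    proof -
      have "g ` {j\<in>J'. v \<in> S j} = (\<lambda>b. if b then p else q) ` h ` {j\<in>J'. v \<in> S j}"
        unfolding image_image by (intro image_cong) (auto simp: g_def)
      also have "\<dots> = {p, q}" unfolding h[OF that] by (auto simp: UNIV_bool)
      finally show ?thesis using pq by simp
    qed
    \<comment> \<open>At a vertex with two or more edges in \<open>J'\<close>, \<open>g\<close>
      shows both \<open>p\<close> and \<open>q\<close>; with at most one such edge, \<open>f\<close>
      and \<open>g\<close> show equally many colours there.\<close>
    have "card (f ` {j\<in>J'. v \<in> S j}) \<le> card (g ` {j\<in>J'. v \<in> S j})" if v: "v \<in> V" for v
    proof (cases "card {j\<in>J'. v \<in> S j} \<ge> 2")
      case True
      have "f ` {j\<in>J'. v \<in> S j} \<subseteq> {p, q}" unfolding J'_def by auto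
      then have "card (f ` {j\<in>J'. v \<in> S j}) \<le> card {p, q}" by (intro card_mono) auto
      then show ?thesis using g2[OF v True] pq by simp
    next
      case False
      then consider "card {j\<in>J'. v \<in> S j} = 0" | "card {j\<in>J'. v \<in> S j} = 1" by linarith
      then show ?thesis
      proof cases
        case 1
        then have "{j\<in>J'. v \<in> S j} = {}" using J'(2) by simp
        then show ?thesis by (simp only: image_empty)
      next
        case 2
        then obtain j where "{j\<in>J'. v \<in> S j} = {j}" by (rule card_1_singletonE)
        then show ?thesis by simp
      qed
    qed
    then have mono: "card (f ` ?D v) \<le> card (g ` ?D v)" if "v \<in> V" for v
      using splitf splitg that by simp
    \<comment> \<open>On the edges of \<open>J'\<close> at \<open>u\<close>, \<open>f\<close> shows
      only \<open>p\<close>; because of \<open>j1\<close> and \<open>j2\<close>, \<open>g\<close>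
      shows both colours.\<close>
    have strict: "card (f ` ?D u) < card (g ` ?D u)"
    proof -
      have "f ` {j\<in>J'. u \<in> S j} \<subseteq> {p}" using q(2) unfolding J'_def by auto
      then have "card (f ` {j\<in>J'. u \<in> S j}) \<le> card {p}" by (intro card_mono) auto
      moreover have "{j1, j2} \<subseteq> {j\<in>J'. u \<in> S j}" using j unfolding J'_def p_def by auto
      then have "card {j1, j2} \<le> card {j\<in>J'. u \<in> S j}" using J'(2) by (intro card_mono) auto
      then have "card (g ` {j\<in>J'. u \<in> S j}) = 2" using g2[OF u] j(3) by simp
      ultimately show ?thesis using splitf splitg by simp
    qed
    have "w f < w g" unfolding w_def
      using mono strict u assms(2) by (intro sum_strict_mono_ex1) auto
    then show False using fmax[OF gd] by simp
  qed
  then show thesis using that f by blast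
qed

section \<open>Transversals and matchings\<close>

text \<open>Weak duality: choosing a point of \<open>T\<close> in each member of \<open>F\<close> is
  injective by disjointness.\<close>

lemma disjoint_card_le_transversal:
  assumes "finite T" "\<And>e. e \<in> F \<Longrightarrow> T \<inter> e \<noteq> {}"
    and "\<And>e e'. e \<in> F \<Longrightarrow> e' \<in> F \<Longrightarrow> e \<noteq> e' \<Longrightarrow> e \<inter> e' = {}"
  shows "card F \<le> card T"
proof -
  have "\<forall>e\<in>F. \<exists>x. x \<in> T \<inter> e" using assms(2) by blast
  then obtain t where t: "\<forall>e\<in>F. t e \<in> T \<inter> e" by (rule bchoice[THEN exE])
  have "inj_on t F"
  proof (rule inj_onI)
    fix e e' assume e: "e \<in> F" "e' \<in> F" "t e = t e'"
    have "t e \<in> e" "t e' \<in> e'" using t e(1,2) by blast+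
    then have "e \<inter> e' \<noteq> {}" using e(3) by auto
    then show "e = e'" using assms(3)[OF e(1,2)] by blast
  qed
  then show ?thesis using t assms(1) by (intro card_inj_on_le[of t]) auto
qed

text \<open>The Berge--Las Vergnas theorem in certificate form: by weak duality, \<open>T\<close>
  and \<open>F\<close> of equal size are a minimum transversal and a maximum matching.\<close>

lemma balanced_koenig:
  assumes "finite V" "\<And>e. e \<in> A \<Longrightarrow> e \<subseteq> V" "{} \<notin> A"
    and "balanced_matrix A V (\<lambda>e v. v \<in> e)"
  shows "\<exists>T F. T \<subseteq> V \<and> (\<forall>e\<in>A. T \<inter> e \<noteq> {}) \<and> F \<subseteq> A \<and>
    (\<forall>e\<in>F. \<forall>e'\<in>F. e \<noteq> e' \<longrightarrow> e \<inter> e' = {}) \<and> card T = card F"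
  using assms(2-)
proof (induction "card A" arbitrary: A rule: less_induct)
  case less
  have finA: "finite A" using less.prems(1) assms(1) by (meson Pow_iff finite_Pow_iff finite_subset subsetI)
  define matching where "matching F \<longleftrightarrow> F \<subseteq> A \<and> (\<forall>e\<in>F. \<forall>e'\<in>F. e \<noteq> e' \<longrightarrow> e \<inter> e' = {})" for F
  have "matching {}" unfolding matching_def by simp
  moreover have "card F < Suc (card A)" if "matching F" for F
    using that finA unfolding matching_def by (simp add: card_mono le_imp_less_Suc)
  ultimately obtain N where N: "matching N" and Nmax: "\<And>F. matching F \<Longrightarrow> card F \<le> card N"
    using ex_has_greatest_nat[of matching "{}" card] by blast
  show ?case
  proof (cases "A = {}")
    case True
    then show ?thesis by (intro exI[of _ "{}"]) simp
  next
    case False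
    then obtain e0 where e0: "e0 \<in> A" by blast
    then have "matching {e0}" unfolding matching_def by simp
    then have Npos: "card N > 0" using Nmax[of "{e0}"] by simp
    have "\<exists>v\<in>V. \<forall>F. matching F \<and> card F = card N \<longrightarrow> (\<exists>e\<in>F. v \<in> e)"
    proof (rule ccontr)
      assume "\<not> ?thesis"
      then obtain F where F: "\<And>v. v \<in> V \<Longrightarrow> matching (F v) \<and> card (F v) = card N \<and> (\<forall>e\<in>F v. v \<notin> e)"
        by metis
      have FA: "F v \<subseteq> A" if "v \<in> V" for v using F[OF that] unfolding matching_def by blast
      have Fdisj: "e = e'" if "v \<in> V" "e \<in> F v" "e' \<in> F v" "u \<in> e" "u \<in> e'" for v e e' u
        using F[OF that(1)] that unfolding matching_def by blast
      \<comment> \<open>Pairs record multiplicities: an edge occurs once for each \<open>v\<close>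
        whose matching \<open>F v\<close> contains it.\<close>
      define J where "J = Sigma V F"
      have finF: "finite (F v)" if "v \<in> V" for v using FA[OF that] finA finite_subset by blast
      have finJ: "finite J" unfolding J_def using assms(1) finF by blast
      have cardJ: "card J = card V * card N"
        unfolding J_def using assms(1) finF F by simp
      have JA: "snd j \<in> A" if "j \<in> J" for j using that FA[of "fst j"] unfolding J_def by auto
      have balJ: "balanced_matrix J V (\<lambda>j v. v \<in> snd j)"
        by (rule balanced_matrix_pullback[OF less.prems(3), of _ snd]) (use JA in auto)
      \<comment> \<open>Each \<open>F v\<close> has at most one edge through \<open>u\<close>, and
        \<open>F u\<close> has none.\<close>
      have deg: "card {j\<in>J. u \<in> snd j} \<le> card V - 1" if u: "u \<in> V" for u
      proof -
        have "inj_on fst {j\<in>J. u \<in> snd j}"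
          using Fdisj unfolding J_def by (fastforce intro!: inj_onI)
        moreover have "fst ` {j\<in>J. u \<in> snd j} \<subseteq> V - {u}" using F unfolding J_def by auto
        ultimately have "card {j\<in>J. u \<in> snd j} \<le> card (V - {u})"
          using assms(1) by (intro card_inj_on_le) auto
        then show ?thesis using u assms(1) by simp
      qed
      \<comment> \<open>The colouring lemma needs a positive number of colours; an edge of
        \<open>F v0\<close> provides a vertex of positive degree.\<close>
      obtain v0 where v0: "v0 \<in> V" using e0 less.prems(1,2) by (metis ex_in_conv subsetD)
      then obtain e1 where e1: "e1 \<in> F v0" using F[OF v0] Npos by fastforce
      then obtain u where u: "u \<in> e1" using FA[OF v0] less.prems(2) by (metis ex_in_conv subsetD)
      then have uV: "u \<in> V" using less.prems(1) FA[OF v0] e1 by blast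
      have "(v0, e1) \<in> {j\<in>J. u \<in> snd j}" using v0 e1 u unfolding J_def by simp
      then have "0 < card {j\<in>J. u \<in> snd j}" using finJ by (auto simp: card_gt_0_iff)
      then have dpos: "card V - 1 > 0" using deg[OF uV] by linarith
      obtain f :: "'a \<times> 'a set \<Rightarrow> nat" where f: "f \<in> J \<rightarrow> {..<card V - 1}"
        "\<And>v. v \<in> V \<Longrightarrow> inj_on f {j\<in>J. v \<in> snd j}"
        using balanced_edge_colouring[OF finJ assms(1) balJ deg dpos] by blast
      \<comment> \<open>Edges of one colour are disjoint. As edges are nonempty, copies of the same
        edge get different colours, so \<open>snd\<close> is injective on a colour class.\<close>
      have colour_class: "card {j\<in>J. f j = i} \<le> card N" for i
      proof -
        let ?Ji = "{j\<in>J. f j = i}"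
        have disj: "j = j'" if "j \<in> ?Ji" "j' \<in> ?Ji" "x \<in> snd j" "x \<in> snd j'" for j j' x
        proof -
          have "x \<in> V" using that JA less.prems(1) by blast
          then show ?thesis using f(2)[of x] that by (auto dest: inj_onD)
        qed
        have "inj_on snd ?Ji"
        proof (rule inj_onI)
          fix j j' assume jj: "j \<in> ?Ji" "j' \<in> ?Ji" "snd j = snd j'"
          then obtain x where "x \<in> snd j" using JA less.prems(2) by (metis (no_types, lifting) ex_in_conv mem_Collect_eq)
          then show "j = j'" using disj[OF jj(1,2)] jj(3) by simp
        qed
        moreover have "matching (snd ` ?Ji)"
          unfolding matching_def using JA disj by blast
        ultimately show ?thesis using Nmax[of "snd ` ?Ji"] card_image[of snd ?Ji] by simp
      qed
      have "J = (\<Union>i<card V - 1. {j\<in>J. f j = i})" using f(1) by auto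
      then have "card J \<le> (\<Sum>i<card V - 1. card {j\<in>J. f j = i})"
        using card_UN_le[of "{..<card V - 1}" "\<lambda>i. {j\<in>J. f j = i}"] by simp
      also have "\<dots> \<le> (\<Sum>i<card V - 1. card N)" by (rule sum_mono) (rule colour_class)
      also have "\<dots> = (card V - 1) * card N" by simp
      also have "\<dots> < card V * card N" using dpos Npos by simp
      finally show False using cardJ by simp
    qed
    then obtain v where v: "v \<in> V"
      "\<And>F. matching F \<Longrightarrow> card F = card N \<Longrightarrow> \<exists>e\<in>F. v \<in> e" by blast
    define A' where "A' = {e\<in>A. v \<notin> e}"
    have "A' \<subset> A" using v(2)[OF N] N unfolding A'_def matching_def by blast
    then have cA': "card A' < card A" using finA by (rule psubset_card_mono[rotated])
    have balA': "balanced_matrix A' V (\<lambda>e v. v \<in> e)"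
      by (rule balanced_matrix_pullback[OF less.prems(3), of _ id]) (auto simp: A'_def)
    have "\<exists>T F. T \<subseteq> V \<and> (\<forall>e\<in>A'. T \<inter> e \<noteq> {}) \<and> F \<subseteq> A' \<and>
      (\<forall>e\<in>F. \<forall>e'\<in>F. e \<noteq> e' \<longrightarrow> e \<inter> e' = {}) \<and> card T = card F"
    proof (rule less.hyps[OF cA' _ _ balA'])
      show "e \<subseteq> V" if "e \<in> A'" for e using that less.prems(1) unfolding A'_def by simp
      show "{} \<notin> A'" using less.prems(2) unfolding A'_def by simp
    qed
    then obtain T F where TF: "T \<subseteq> V" "\<forall>e\<in>A'. T \<inter> e \<noteq> {}" "F \<subseteq> A'"
      "\<forall>e\<in>F. \<forall>e'\<in>F. e \<noteq> e' \<longrightarrow> e \<inter> e' = {}" "card T = card F"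
      by - (elim exE conjE, rule that)
    have mF: "matching F" using TF \<open>A' \<subset> A\<close> unfolding matching_def by blast
    have "card F \<noteq> card N" using v(2)[OF mF] TF(3) unfolding A'_def by blast
    then have "card F < card N" using Nmax[OF mF] by simp
    have finT: "finite T" using TF(1) assms(1) finite_subset by blast
    let ?T = "insert v T"
    have cov: "\<forall>e\<in>A. ?T \<inter> e \<noteq> {}" using TF(2) unfolding A'_def by auto
    have "card ?T \<le> card N" using card_insert_le_m1[of "card N" T v] \<open>card F < card N\<close> TF(5) finT
      by (simp add: card_insert_if)
    \<comment> \<open>The matching paired with \<open>?T\<close> is \<open>N\<close>, not the
      \<open>F\<close> of the induction hypothesis; weak duality gives this inequality.\<close>
    moreover have "card N \<le> card ?T"
      by (rule disjoint_card_le_transversal) (use finT cov N in \<open>auto simp: matching_def\<close>)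
    ultimately have "card ?T = card N" by simp
    then show ?thesis using cov N v(1) TF(1) unfolding matching_def
      by (intro exI[of _ ?T] exI[of _ N]) simp
  qed
qed

section \<open>Clique matrices and the clique parameters\<close>

lemma is_clique_extend_max:
  assumes "finite V" "is_clique V E K"
  obtains K' where "max_clique V E K'" "K \<subseteq> K'"
proof -
  have "finite {L. is_clique V E L}"
    by (rule finite_subset[of _ "Pow V"]) (auto simp: is_clique_def assms(1))
  then obtain L where L: "is_clique V E L" "K \<subseteq> L" "\<And>M. is_clique V E M \<Longrightarrow> L \<subseteq> M \<Longrightarrow> M = L"
    using finite_has_maximal2[of "{L. is_clique V E L}" K] assms(2) by auto
  then show thesis using that unfolding max_clique_def by blast
qed

lemma max_cliquesD:
  assumes "K \<in> max_cliques V E"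
  shows "K \<subseteq> V" "K \<noteq> {}"
  using assms by (simp_all add: max_cliques_def max_clique_def is_clique_def)

lemma max_clique_is_clique: "max_clique V E K \<Longrightarrow> is_clique V E K"
  by (simp add: max_clique_def)

lemma max_clique_eqI: "max_clique V E K \<Longrightarrow> is_clique V E L \<Longrightarrow> K \<subseteq> L \<Longrightarrow> L = K"
  by (simp add: max_clique_def)

lemma finite_max_cliques: "finite V \<Longrightarrow> finite (max_cliques V E)"
  by (rule finite_subset[of _ "Pow V"]) (auto dest: max_cliquesD(1))

text \<open>Each maximal clique of the induced subgraph is the trace on \<open>W\<close> of a
  maximal clique of the whole graph, so its clique matrix is a pullback.\<close>

lemma balanced_graph_induced:
  assumes "finite V" "balanced_graph V E" "W \<subseteq> V"
  shows "balanced_graph W E"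
proof -
  have "\<exists>L. max_clique V E L \<and> L \<inter> W = K" if K: "max_clique W E K" for K
  proof -
    have "is_clique V E K"
      using max_clique_is_clique[OF K] assms(3) unfolding is_clique_def by auto
    then obtain L where L: "max_clique V E L" "K \<subseteq> L" using is_clique_extend_max assms(1) by metis
    have "is_clique W E (L \<inter> W)" "K \<subseteq> L \<inter> W"
      using max_clique_is_clique[OF L(1)] max_clique_is_clique[OF K] L(2)
      unfolding is_clique_def by auto
    then have "L \<inter> W = K" by (rule max_clique_eqI[OF K])
    then show ?thesis using L(1) by blast
  qed
  then have "\<forall>K\<in>max_cliques W E. \<exists>L. max_clique V E L \<and> L \<inter> W = K"
    unfolding max_cliques_def by blast
  then obtain g where g: "\<forall>K\<in>max_cliques W E. max_clique V E (g K) \<and> g K \<inter> W = K"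
    by (rule bchoice[THEN exE])
  show ?thesis
    unfolding balanced_graph_def
  proof (rule balanced_matrix_pullback[OF assms(2)[unfolded balanced_graph_def]])
    show "g K \<in> max_cliques V E" if "K \<in> max_cliques W E" for K
      using g that by (simp add: max_cliques_def)
    show "v \<in> K \<longleftrightarrow> v \<in> g K" if "K \<in> max_cliques W E" "v \<in> W" for K v
    proof -
      have "g K \<inter> W = K" using g that(1) by blast
      then show ?thesis using that(2) by (metis Int_iff)
    qed
  qed (rule assms(3))
qed

text \<open>The given \<open>T\<close> and \<open>F\<close> also show that the sets under
  \<open>Min\<close> and \<open>Max\<close> are nonempty, so that both extrema are attained.\<close>

lemma tau_c_alpha_c_bounds:
  assumes "finite V" "clique_transversal V E T" "clique_independent V E F"
  shows "tau_c V E \<le> card T" "card F \<le> alpha_c V E"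
    "\<exists>T'. clique_transversal V E T' \<and> tau_c V E = card T'"
    "\<exists>F'. clique_independent V E F' \<and> alpha_c V E = card F'"
proof -
  have T: "finite {card T |T. clique_transversal V E T}"
    by (rule finite_surj[of "Pow V" _ card]) (auto simp: assms(1) clique_transversal_def)
  have F: "finite {card F |F. clique_independent V E F}"
    by (rule finite_surj[of "Pow (max_cliques V E)" _ card])
      (auto simp: assms(1) finite_max_cliques clique_independent_def)
  show "tau_c V E \<le> card T" unfolding tau_c_def using assms(2) T by (intro Min_le) auto
  show "card F \<le> alpha_c V E" unfolding alpha_c_def using assms(3) F by (intro Max_ge) auto
  show "\<exists>T'. clique_transversal V E T' \<and> tau_c V E = card T'"
    using Min_in[OF T] assms(2) unfolding tau_c_def by blast
  show "\<exists>F'. clique_independent V E F' \<and> alpha_c V E = card F'"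
    using Max_in[OF F] assms(3) unfolding alpha_c_def by blast
qed

text \<open>The certificate from \<open>balanced_koenig\<close> bounds \<open>tau_c\<close> by
  \<open>alpha_c\<close>; weak duality gives the converse.\<close>

lemma balanced_graph_tau_c_eq_alpha_c:
  assumes "finite V" "balanced_graph V E"
  shows "tau_c V E = alpha_c V E"
proof -
  have "\<exists>T F. T \<subseteq> V \<and> (\<forall>e\<in>max_cliques V E. T \<inter> e \<noteq> {}) \<and> F \<subseteq> max_cliques V E \<and>
    (\<forall>e\<in>F. \<forall>e'\<in>F. e \<noteq> e' \<longrightarrow> e \<inter> e' = {}) \<and> card T = card F"
  proof (rule balanced_koenig[OF assms(1)])
    show "balanced_matrix (max_cliques V E) V (\<lambda>e v. v \<in> e)"
      using assms(2) unfolding balanced_graph_def .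
  qed (auto dest: max_cliquesD)
  then obtain T F where "T \<subseteq> V" "\<forall>e\<in>max_cliques V E. T \<inter> e \<noteq> {}" "F \<subseteq> max_cliques V E"
    "\<forall>e\<in>F. \<forall>e'\<in>F. e \<noteq> e' \<longrightarrow> e \<inter> e' = {}" "card T = card F"
    by - (elim exE conjE, rule that)
  then have TF: "clique_transversal V E T" "clique_independent V E F" "card T = card F"
    by (simp_all add: clique_transversal_def clique_independent_def)
  note b = tau_c_alpha_c_bounds[OF assms(1) TF(1,2)]
  obtain T' F' where TF': "clique_transversal V E T'" "tau_c V E = card T'"
    "clique_independent V E F'" "alpha_c V E = card F'" using b(3,4) by blast
  have "card F' \<le> card T'"
  proof (rule disjoint_card_le_transversal)
    show "finite T'" using TF'(1) assms(1) finite_subset unfolding clique_transversal_def by blast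
  qed (use TF' in \<open>auto simp: clique_transversal_def clique_independent_def\<close>)
  then show ?thesis using b(1,2) TF(3) TF' by simp
qed

section \<open>Diamond-free graphs\<close>

text \<open>Otherwise maximality of \<open>K\<close> yields some \<open>z\<close> in
  \<open>K\<close> not adjacent to \<open>w\<close>, and \<open>a\<close>, \<open>b\<close>,
  \<open>z\<close>, \<open>w\<close> induce a diamond.\<close>

lemma diamond_free_clique_absorbs:
  assumes "simple_graph V E" "diamond_free V E" "max_clique V E K"
    and "a \<in> K" "b \<in> K" "a \<noteq> b" and "E a w" "E b w"
  shows "w \<in> K"
proof (rule ccontr)
  assume w: "w \<notin> K"
  have K: "K \<subseteq> V" "\<And>x y. x \<in> K \<Longrightarrow> y \<in> K \<Longrightarrow> x \<noteq> y \<Longrightarrow> E x y"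
    using assms(3) unfolding max_clique_def is_clique_def by auto
  have sym: "E x y \<Longrightarrow> E y x" for x y using assms(1) unfolding simple_graph_def by blast
  have wV: "w \<in> V" using assms(1,7) unfolding simple_graph_def by blast
  have "\<not> is_clique V E (insert w K)" using assms(3) w unfolding max_clique_def by blast
  moreover have "is_clique V E (insert w K)" if "\<forall>z\<in>K. E z w"
    using that K wV sym unfolding is_clique_def by auto
  ultimately obtain z where z: "z \<in> K" "\<not> E z w" by blast
  then have "distinct [a, b, z, w]" "E a b" "E a z" "E b z"
    using assms(4-) w K(2) by auto
  then show False using assms(2,4,5,7,8) z K(1) wV unfolding diamond_free_def by blast
qed

lemma diamond_free_clique_perfect_imp_balanced:
  assumes "simple_graph V E" "diamond_free V E" "clique_perfect V E"
  shows "balanced_graph V E"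
proof (rule ccontr)
  assume "\<not> balanced_graph V E"
  then obtain R W where R: "R \<subseteq> max_cliques V E" "finite R" and W: "W \<subseteq> V" "finite W"
    and card: "card R = card W" "odd (card R)"
    and rows: "\<And>K. K \<in> R \<Longrightarrow> card {v\<in>W. v \<in> K} = 2"
    and cols: "\<And>v. v \<in> W \<Longrightarrow> card {K\<in>R. v \<in> K} = 2"
    unfolding balanced_graph_def balanced_matrix_def by blast
  \<comment> \<open>The row \<open>K\<close> meets \<open>W\<close> in two vertices \<open>a\<close>
    and \<open>b\<close>; a vertex of \<open>W\<close> adjacent to both is absorbed by
    \<open>K\<close> and hence is one of them.\<close>
  have tr: "max_clique W E (W \<inter> K)" if K: "K \<in> R" for K
  proof -
    have mK: "max_clique V E K" using K R(1) unfolding max_cliques_def by blast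
    obtain a b where ab: "W \<inter> K = {a, b}" "a \<noteq> b"
      using rows[OF K] by (auto simp: card_2_iff Collect_conj_eq)
    have "is_clique W E (W \<inter> K)" using mK ab unfolding max_clique_def is_clique_def by blast
    moreover have "L \<subseteq> W \<inter> K" if L: "is_clique W E L" "W \<inter> K \<subseteq> L" for L
    proof
      fix w assume w: "w \<in> L"
      have "w \<in> K"
      proof (cases "w = a \<or> w = b")
        case False
        then have "E a w" "E b w" using L w ab unfolding is_clique_def by auto
        then show ?thesis using diamond_free_clique_absorbs[OF assms(1,2) mK] ab by blast
      qed (use ab in blast)
      then show "w \<in> W \<inter> K" using w L(1) unfolding is_clique_def by blast
    qed
    ultimately show ?thesis unfolding max_clique_def by blast
  qed
  have tau: "card R \<le> 2 * card T" if T: "clique_transversal W E T" for T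
  proof -
    have TW: "T \<subseteq> W" using T unfolding clique_transversal_def by blast
    have "R \<subseteq> (\<Union>v\<in>T. {K\<in>R. v \<in> K})"
      using T tr unfolding clique_transversal_def max_cliques_def by blast
    moreover have finT: "finite T" using TW W(2) finite_subset by blast
    ultimately have "card R \<le> card (\<Union>v\<in>T. {K\<in>R. v \<in> K})"
      using R(2) by (intro card_mono) auto
    also have "\<dots> \<le> (\<Sum>v\<in>T. card {K\<in>R. v \<in> K})" by (rule card_UN_le[OF finT])
    also have "\<dots> = (\<Sum>v\<in>T. 2)" using cols TW by (intro sum.cong) auto
    finally show ?thesis by simp
  qed
  \<comment> \<open>Each vertex of \<open>W\<close> lies in some row, whose trace on
    \<open>W\<close> is a clique of two vertices, so no single vertex is a maximal clique.\<close>
  have big: "card K \<ge> 2" if K: "max_clique W E K" for K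
  proof -
    obtain v where v: "v \<in> K" "v \<in> W" using K unfolding max_clique_def is_clique_def by blast
    have "{K\<in>R. v \<in> K} \<noteq> {}"
      using card_gt_0_iff[of "{K\<in>R. v \<in> K}"] cols[OF v(2)] by simp
    then obtain Q where Q: "Q \<in> R" "v \<in> Q" by blast
    have "finite K" using K W(2) finite_subset unfolding max_clique_def is_clique_def by blast
    moreover have "K \<noteq> {v}"
    proof
      assume "K = {v}"
      then have "W \<inter> Q = {v}" using K tr[OF Q(1)] Q(2) v(2) unfolding max_clique_def by blast
      then show False using rows[OF Q(1)] by (simp add: Collect_conj_eq)
    qed
    ultimately have "card {v} < card K" using v(1) by (intro psubset_card_mono) auto
    then show ?thesis by simp
  qed
  have alpha: "2 * card F \<le> card W" if F: "clique_independent W E F" for F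
  proof -
    have FW: "K \<subseteq> W" if "K \<in> F" for K
      using F that unfolding clique_independent_def max_cliques_def max_clique_def is_clique_def by blast
    have finF: "finite F"
      using F finite_max_cliques[OF W(2)] finite_subset unfolding clique_independent_def by blast
    have "2 * card F = (\<Sum>K\<in>F. 2)" by simp
    also have "\<dots> \<le> (\<Sum>K\<in>F. card K)"
      using F big unfolding clique_independent_def max_cliques_def by (intro sum_mono) blast
    also have "\<dots> = card (\<Union>F)"
      using F finite_subset[OF FW W(2)]
      by (subst card_Union_disjoint) (auto simp: clique_independent_def pairwise_def disjnt_def)
    also have "\<dots> \<le> card W" using FW W(2) by (intro card_mono) auto
    finally show ?thesis .
  qed
  have W_tr: "clique_transversal W E W"
    unfolding clique_transversal_def using max_cliquesD[of _ W E] by blast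
  have empty_ind: "clique_independent W E {}"
    unfolding clique_independent_def by simp
  obtain T where T: "clique_transversal W E T" "tau_c W E = card T"
    using tau_c_alpha_c_bounds(3)[OF W(2) W_tr empty_ind] by blast
  obtain F where F: "clique_independent W E F" "alpha_c W E = card F"
    using tau_c_alpha_c_bounds(4)[OF W(2) W_tr empty_ind] by blast
  have "tau_c W E = alpha_c W E" using assms(3) W(1) unfolding clique_perfect_def by blast
  \<comment> \<open>Both bounds become equalities because \<open>card R = card W\<close>, which
    makes the odd number \<open>card R\<close> even.\<close>
  then have "2 * card T = card R" using tau[OF T(1)] alpha[OF F(1)] T(2) F(2) card(1) by linarith
  then show False using card(2) by presburger
qed

theorem theorem10:
  fixes V :: "'a set" and E :: "'a \<Rightarrow> 'a \<Rightarrow> bool"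
  assumes "simple_graph V E"
    and "diamond_free V E"
  shows "clique_perfect V E \<longleftrightarrow> balanced_graph V E"
proof
  assume "clique_perfect V E"
  then show "balanced_graph V E" using diamond_free_clique_perfect_imp_balanced assms by blast
next
  assume bal: "balanced_graph V E"
  have "finite V" using assms(1) unfolding simple_graph_def by blast
  then show "clique_perfect V E" unfolding clique_perfect_def
    using balanced_graph_induced[OF _ bal] balanced_graph_tau_c_eq_alpha_c finite_subset by metis
qed

end
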